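(* Let $G$ be a weighted, marked graph and suppose $v_1,\dots,v_k\in V(G)$ are unlooped twins that form a clique in $G$, i.e., $v_1,\dots,v_k$ are unlooped, all have the same neighbors outside $\{v_1,\dots,v_k\}$, and are all adjacent to each other. Let $\rho=|\{i : v_i\text{ is not marked}\}|$. Let $(G-v_2-\dots-v_k)'$ be the graph obtained from $G-v_2-\dots-v_k$ by (i) making $v_1$ marked if $\rho$ is even and unmarked if $\rho$ is odd, and (ii) changing the weights of $v_1$ to $$\alpha'(v_1)=\prod_{i=1}^k\alpha(v_i)\quad\text{and}\quad \beta'(v_1)=d^{-1}\Big(-\alpha'(v_1)+\prod_{i=1}^k(\alpha(v_i)+d\,\beta(v_i))\Big).$$ Then $[G]=[(G-v_2-\dots-v_k)']$.
   Context: A graph $G=(V(G),E(G))$ is finite and may have loops, multiple edges, and free loops (connected components that contain neither vertices nor edges). A marked graph is a graph each of whose vertices is designated either marked or unmarked. A weighted, marked graph is a marked graph given with functions $\alpha,\beta:V(G)\to R$, where $R$ is a commutative ring containing the element $d$, and $d$ is not a zero divisor in $R$ (for instance $d$ is an independent variable). The element $d^{-1}(\cdots)$ in the claim is the unique $x\in R$ with $dx=(\cdots)$; it exists because $\prod_i(\alpha(v_i)+d\beta(v_i))-\prod_i\alpha(v_i)$ is a multiple of $d$. If $V(G)=\{v_1,\dots,v_n\}$, the Boolean adjacency matrix $\mathcal{A}(G)$ is the $n\times n$ matrix over $GF(2)$ with $\mathcal{A}(G)_{ii}=1$ iff $v_i$ is looped and, for $i\neq j$, $\mathcal{A}(G)_{ij}=1$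 iff $v_i$ and $v_j$ are adjacent. For $T\subseteq V(G)$, $\mathcal{A}(G)_T$ is obtained from $\mathcal{A}(G)$ by first changing the $i$th diagonal entry whenever $v_i\in T$, and then removing the $i$th row and column whenever $v_i$ is marked and the (new) $i$th diagonal entry is $0$. The weighted marked-graph bracket polynomial is $$[G]=d^{\phi}\sum_{T\subseteq V(G)}\Big(\prod_{v\notin T}\alpha(v)\Big)\Big(\prod_{t\in T}\beta(t)\Big)d^{\nu(\mathcal{A}(G)_T)},$$ where $\phi$ is the number of free loops of $G$ and $\nu$ is the $GF(2)$-nullity (the empty matrix has nullity $0$). $G-v$ is obtained from $G$ by removing $v$ and every edge incident on $v$; remaining vertices keep their loops, marks and weights, and free loops are unaffected. *)

theory Defs
  imports Complex_Main "HOL-Library.Function_Algebras" "HOL-Library.Z2"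
begin

text \<open>
  An edge is sent to the set of its end-points, so a loop is an edge with exactly one end-point, and
  multiple edges are distinct edges with the same end-points.  Free loops have neither vertices nor
  edges and are only counted.
\<close>

record ('v, 'e, 'r) wm_graph =
  verts :: "'v set"
  edges :: "'e set"
  ends :: "'e \<Rightarrow> 'v set"
  free_loops :: nat
  marked :: "'v \<Rightarrow> bool"
  alpha :: "'v \<Rightarrow> 'r"
  beta :: "'v \<Rightarrow> 'r"

definition wf_graph :: "('v, 'e, 'r) wm_graph \<Rightarrow> bool" where
  "wf_graph G \<longleftrightarrow> finite (verts G) \<and> finite (edges G) \<and>
     (\<forall>e\<in>edges G. ends G e \<subseteq> verts G \<and> (card (ends G e) = 1 \<or> card (ends G e) = 2))"

definition looped :: "('v, 'e, 'r) wm_graph \<Rightarrow> 'v \<Rightarrow> bool" where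
  "looped G v \<longleftrightarrow> (\<exists>e\<in>edges G. ends G e = {v})"

definition adjacent :: "('v, 'e, 'r) wm_graph \<Rightarrow> 'v \<Rightarrow> 'v \<Rightarrow> bool" where
  "adjacent G u v \<longleftrightarrow> u \<noteq> v \<and> (\<exists>e\<in>edges G. ends G e = {u, v})"

definition neighbors :: "('v, 'e, 'r) wm_graph \<Rightarrow> 'v \<Rightarrow> 'v set" where
  "neighbors G v = {u \<in> verts G. adjacent G v u}"

definition delete_vertex :: "('v, 'e, 'r) wm_graph \<Rightarrow> 'v \<Rightarrow> ('v, 'e, 'r) wm_graph" where
  "delete_vertex G w = G\<lparr>verts := verts G - {w}, edges := {e \<in> edges G. w \<notin> ends G e}\<rparr>"

text \<open>
  A square matrix over \<open>GF(2)\<close> is a function of two vertices together with a finite set of vertices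
  indexing its rows and columns; deleting rows and columns shrinks the index set.  A vector indexed
  by \<open>I\<close> is a function on all vertices that vanishes outside \<open>I\<close>.
\<close>

interpretation gf2: vector_space "\<lambda>(c::bit) (x::'v \<Rightarrow> bit) v. c * x v"
  by unfold_locales (auto simp: algebra_simps fun_eq_iff)

definition kernel :: "'v set \<Rightarrow> ('v \<Rightarrow> 'v \<Rightarrow> bit) \<Rightarrow> ('v \<Rightarrow> bit) set" where
  "kernel I A = {x. (\<forall>v. v \<notin> I \<longrightarrow> x v = 0) \<and> (\<forall>u\<in>I. (\<Sum>v\<in>I. A u v * x v) = 0)}"

definition nullity :: "'v set \<Rightarrow> ('v \<Rightarrow> 'v \<Rightarrow> bit) \<Rightarrow> nat" where
  "nullity I A = gf2.dim (kernel I A)"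

definition adj_matrix :: "('v, 'e, 'r) wm_graph \<Rightarrow> 'v \<Rightarrow> 'v \<Rightarrow> bit" where
  "adj_matrix G u v = (if u = v then of_bool (looped G u) else of_bool (adjacent G u v))"

definition toggled_matrix :: "('v, 'e, 'r) wm_graph \<Rightarrow> 'v set \<Rightarrow> 'v \<Rightarrow> 'v \<Rightarrow> bit" where
  "toggled_matrix G T u v = (if u = v \<and> u \<in> T then adj_matrix G u v + 1 else adj_matrix G u v)"

definition retained :: "('v, 'e, 'r) wm_graph \<Rightarrow> 'v set \<Rightarrow> 'v set" where
  "retained G T = {v \<in> verts G. \<not> (marked G v \<and> toggled_matrix G T v v = 0)}"

definition bracket :: "'r::comm_ring_1 \<Rightarrow> ('v, 'e, 'r) wm_graph \<Rightarrow> 'r" where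
  "bracket d G = d ^ free_loops G *
     (\<Sum>T\<in>Pow (verts G). (\<Prod>v\<in>verts G - T. alpha G v) * (\<Prod>t\<in>T. beta G t) *
        d ^ nullity (retained G T) (toggled_matrix G T))"

definition not_zero_divisor :: "'r::comm_ring_1 \<Rightarrow> bool" where
  "not_zero_divisor d \<longleftrightarrow> (\<forall>x. d * x = 0 \<longrightarrow> x = 0)"

text \<open>The quotient \<open>d\<^sup>-\<^sup>1y\<close>; meaningful only if \<open>d\<close> is not a zero divisor and divides \<open>y\<close>.\<close>

definition quot_by :: "'r::comm_ring_1 \<Rightarrow> 'r \<Rightarrow> 'r" where
  "quot_by d y = (THE x. d * x = y)"

lemma quot_by_eqI:
  assumes "not_zero_divisor d" and "d * x = y"
  shows "quot_by d y = x"
  unfolding quot_by_def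
proof (rule the_equality)
  fix z assume "d * z = y"
  with assms(2) have "d * (z - x) = 0" by (simp add: right_diff_distrib)
  with assms(1) have "z - x = 0" unfolding not_zero_divisor_def by blast
  then show "z = x" by simp
qed (fact assms(2))

lemma dvd_prod_add_mult_diff:
  fixes d :: "'r::comm_ring_1"
  shows "d dvd - (\<Prod>i\<in>I. a i) + (\<Prod>i\<in>I. a i + d * b i)"
proof (induction I rule: infinite_finite_induct)
  case (insert j I)
  have "- (\<Prod>i\<in>insert j I. a i) + (\<Prod>i\<in>insert j I. a i + d * b i) =
     a j * (- (\<Prod>i\<in>I. a i) + (\<Prod>i\<in>I. a i + d * b i)) + d * (b j * (\<Prod>i\<in>I. a i + d * b i))"
    using insert.hyps by (simp add: algebra_simps)
  with insert.IH show ?case by (simp add: dvd_mult)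
qed auto

lemma mult_quot_by:
  assumes "not_zero_divisor d"
  shows "d * quot_by d (- (\<Prod>i\<in>I. a i) + (\<Prod>i\<in>I. a i + d * b i)) =
    - (\<Prod>i\<in>I. a i) + (\<Prod>i\<in>I. a i + d * b i)"
  using quot_by_eqI[OF assms] dvd_prod_add_mult_diff[of d a I b] by (metis dvdE)

end

theory Submission
  imports Defs
begin

text \<open>
  Split the sum over \<open>T\<close> according to the part \<open>S\<close> of \<open>T\<close> inside the clique \<open>C\<close> of twins.  If
  \<open>S\<close> is nonempty, the rows of its members coincide, and subtracting one of them from the row of an
  unmarked twin outside \<open>S\<close> leaves a unit vector; so the nullity is \<open>card S - 1\<close> plus the nullity
  obtained when \<open>C\<close> is a single toggled vertex.  If \<open>S\<close> is empty, only the unmarked twins remain,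
  and a kernel vector is constant on them; so only the parity of their number matters: an odd number
  acts like one unmarked vertex, an even number like none.  Summing \<open>d ^ (card S - 1)\<close> with its
  weights over the nonempty \<open>S\<close> gives \<open>\<beta>'(v\<^sub>1)\<close>.

  Nullities are compared by counting: over \<open>GF(2)\<close> a kernel of dimension \<open>n\<close> has \<open>2 ^ n\<close> elements,
  so bijections between kernels suffice.
\<close>

text \<open>
  These rules rewrite the field operations on \<^typ>\<open>bit\<close> to bit operations and would
  disable all ring reasoning.
\<close>
declare add_bit_eq_xor [simp del] mult_bit_eq_and [simp del]
  minus_bit_def [simp del] uminus_bit_def [simp del]

section \<open>Counting kernels over GF(2)\<close>

text \<open>The only scalars are 0 and 1, so adjoining \<open>b\<close> to \<open>B\<close> adds to
  the span just the coset \<open>b\<close> + span \<open>B\<close>. It is disjoint from the span of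
  \<open>B\<close> because \<open>b\<close> is independent of \<open>B\<close>, so each basis vector
  doubles the size.\<close>

lemma card_span_gf2:
  assumes "finite B" "gf2.independent (B :: ('v \<Rightarrow> bit) set)"
  shows "finite (gf2.span B) \<and> card (gf2.span B) = 2 ^ card B"
  using assms
proof (induction B)
  case (insert b B)
  have b: "b \<notin> gf2.span B" and ind: "gf2.independent B"
    using insert.prems insert.hyps by (auto simp: gf2.independent_insert)
  have scale: "(\<lambda>v. k * b v) = (if k = 0 then 0 else b)" for k :: bit
    by (cases k) (auto simp: fun_eq_iff)
  have "gf2.span (insert b B) = gf2.span B \<union> (+) b ` gf2.span B"
  proof (intro set_eqI iffI)
    fix x assume "x \<in> gf2.span (insert b B)"
    then obtain k where "x - (\<lambda>v. k * b v) \<in> gf2.span B" by (auto simp: gf2.span_insert)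
    then have "x \<in> gf2.span B \<or> x - b \<in> gf2.span B" unfolding scale by (auto split: if_splits)
    then show "x \<in> gf2.span B \<union> (+) b ` gf2.span B"
      by (auto intro!: image_eqI[of _ _ "x - b"])
  next
    fix x assume "x \<in> gf2.span B \<union> (+) b ` gf2.span B"
    then show "x \<in> gf2.span (insert b B)"
      by (auto intro: gf2.span_add gf2.span_base simp: gf2.span_mono[THEN subsetD, OF subset_insertI])
  qed
  moreover have "gf2.span B \<inter> (+) b ` gf2.span B = {}"
    using b by (auto simp: gf2.span_add_eq2)
  moreover have "card ((+) b ` gf2.span B) = card (gf2.span B)"
    by (intro card_image) (auto simp: inj_on_def)
  ultimately show ?case
    using insert.IH[OF ind] insert.hyps by (simp add: card_Un_disjoint)
qed (simp add: gf2.span_empty)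

text \<open>A vector over GF(2) vanishing outside \<open>I\<close> is the indicator function of a
  subset of \<open>I\<close>.\<close>

lemma finite_kernel:
  assumes "finite I"
  shows "finite (kernel I A)"
proof (rule finite_subset)
  show "kernel I A \<subseteq> (\<lambda>X v. of_bool (v \<in> X)) ` Pow I"
  proof
    fix x assume "x \<in> kernel I A"
    then have "{v. x v = 1} \<subseteq> I" by (auto simp: kernel_def)
    moreover have "x = (\<lambda>v. of_bool (v \<in> {v. x v = 1}))"
      by (auto simp: fun_eq_iff)
    ultimately show "x \<in> (\<lambda>X v. of_bool (v \<in> X)) ` Pow I" by blast
  qed
qed (use assms in simp)

lemma subspace_kernel: "gf2.subspace (kernel I A)"
  unfolding gf2.subspace_def kernel_def
  by (simp add: distrib_left sum.distrib mult.left_commute[of _ "_::bit"] flip: sum_distrib_left)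

lemma card_kernel:
  assumes "finite I"
  shows "card (kernel I A) = 2 ^ nullity I A"
proof -
  obtain B where B: "B \<subseteq> kernel I A" "gf2.independent B" "kernel I A \<subseteq> gf2.span B"
      "card B = nullity I A"
    using gf2.basis_exists[of "kernel I A"] unfolding nullity_def by metis
  have "finite B" using B(1) finite_kernel[OF assms] finite_subset by blast
  moreover have "gf2.span B = kernel I A"
    using B(1,3) gf2.span_minimal[OF _ subspace_kernel] by blast
  ultimately show ?thesis using card_span_gf2 B(2,4) by metis
qed

lemma nullity_cong:
  assumes "\<And>u v. u \<in> I \<Longrightarrow> v \<in> I \<Longrightarrow> A u v = B u v"
  shows "nullity I A = nullity I B"
proof -
  have "kernel I A = kernel I B"
    unfolding kernel_def using assms by (auto cong: sum.cong)
  then show ?thesis by (simp add: nullity_def)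
qed

section \<open>Matrices with a clique of twins\<close>

text \<open>
  \<open>R\<close> indexes the vertices outside the clique; every other index is a twin, with the same
  adjacency \<open>c\<close> to \<open>R\<close>, and its diagonal entry is 1 exactly if it is toggled (is in \<open>S\<close>).
\<close>
definition twin_matrix :: "'v set \<Rightarrow> ('v \<Rightarrow> 'v \<Rightarrow> bit) \<Rightarrow> ('v \<Rightarrow> bit) \<Rightarrow> 'v set \<Rightarrow> 'v \<Rightarrow> 'v \<Rightarrow> bit"
  where "twin_matrix R B c S y z =
    (if y \<in> R then (if z \<in> R then B y z else c y)
     else if z \<in> R then c z else of_bool (y = z \<longrightarrow> y \<in> S))"

text \<open>The twins have equal entries in each row of \<open>R\<close>, so those rows see the
  twins only through \<open>sum x C\<close>. On \<open>C\<close>, the row of a twin \<open>u\<close>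
  is all 1, except for a 0 at \<open>u\<close> itself if \<open>u\<close> is not toggled; that
  exception becomes the term in \<open>x u\<close> on the right-hand side.\<close>

lemma kernel_twin_matrix_iff:
  assumes "finite R" "finite C" "R \<inter> C = {}"
  shows "x \<in> kernel (R \<union> C) (twin_matrix R B c S) \<longleftrightarrow>
    (\<forall>v. v \<notin> R \<union> C \<longrightarrow> x v = 0) \<and>
    (\<forall>y\<in>R. (\<Sum>z\<in>R. B y z * x z) + c y * sum x C = 0) \<and>
    (\<forall>u\<in>C. (\<Sum>z\<in>R. c z * x z) + sum x C = of_bool (u \<notin> S) * x u)"
proof -
  have 1: "(\<Sum>z\<in>R \<union> C. twin_matrix R B c S y z * x z) = (\<Sum>z\<in>R. B y z * x z) + c y * sum x C"
    if "y \<in> R" for y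
  proof -
    have "(\<Sum>z\<in>C. twin_matrix R B c S y z * x z) = (\<Sum>z\<in>C. c y * x z)"
      using assms that by (intro sum.cong) (auto simp: twin_matrix_def)
    then show ?thesis
      using assms that by (simp add: sum.union_disjoint sum_distrib_left twin_matrix_def)
  qed
  have 2: "(\<Sum>z\<in>R \<union> C. twin_matrix R B c S u z * x z) =
      (\<Sum>z\<in>R. c z * x z) + sum x C - of_bool (u \<notin> S) * x u" if "u \<in> C" for u
  proof -
    have "u \<notin> R" using assms(3) that by auto
    have "(\<Sum>z\<in>C. twin_matrix R B c S u z * x z) =
        (\<Sum>z\<in>C. x z - (if z = u then of_bool (u \<notin> S) * x u else 0))"
      using assms that by (intro sum.cong) (auto simp: twin_matrix_def)
    also have "\<dots> = sum x C - of_bool (u \<notin> S) * x u"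
      using assms(2) that by (simp add: sum_subtractf)
    finally show ?thesis
      using assms \<open>u \<notin> R\<close> by (simp add: sum.union_disjoint twin_matrix_def)
  qed
  have "(\<forall>u\<in>R \<union> C. (\<Sum>z\<in>R \<union> C. twin_matrix R B c S u z * x z) = 0) \<longleftrightarrow>
      (\<forall>y\<in>R. (\<Sum>z\<in>R. B y z * x z) + c y * sum x C = 0) \<and>
      (\<forall>u\<in>C. (\<Sum>z\<in>R. c z * x z) + sum x C - of_bool (u \<notin> S) * x u = 0)"
    using 1 2 by (simp add: ball_Un)
  then show ?thesis unfolding kernel_def mem_Collect_eq right_minus_eq by blast
qed

section \<open>Nullity when some twin is toggled\<close>

text \<open>The row of a toggled twin says that the sum over \<open>R\<close> plus
  \<open>sum x C\<close> is 0. Compared with it, the row of an untoggled twin \<open>u\<close> says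
  \<open>x u = 0\<close>, so the untoggled twins can be deleted.\<close>

lemma nullity_twin_matrix_drop:
  assumes "finite R" "finite C" "R \<inter> C = {}" "S \<subseteq> C" "S \<noteq> {}"
  shows "nullity (R \<union> C) (twin_matrix R B c S) = nullity (R \<union> S) (twin_matrix R B c S)"
proof -
  have fin: "finite S" and disj: "R \<inter> S = {}" using assms finite_subset by auto
  have "x \<in> kernel (R \<union> C) (twin_matrix R B c S) \<longleftrightarrow> x \<in> kernel (R \<union> S) (twin_matrix R B c S)"
    for x
  proof -
    let ?p = "\<Sum>z\<in>R. c z * x z"
    have supp: "sum x C = sum x S" if "\<forall>u\<in>C - S. x u = 0"
      using assms(2,4) that by (intro sum.mono_neutral_right) auto
    have C: "(\<forall>u\<in>C. ?p + sum x C = of_bool (u \<notin> S) * x u) \<longleftrightarrow>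
        ?p + sum x C = 0 \<and> (\<forall>u\<in>C - S. x u = 0)"
    proof
      assume *: "\<forall>u\<in>C. ?p + sum x C = of_bool (u \<notin> S) * x u"
      obtain s where "s \<in> S" using assms(5) by blast
      then have "?p + sum x C = 0" using * assms(4) by force
      with * show "?p + sum x C = 0 \<and> (\<forall>u\<in>C - S. x u = 0)" by force
    qed auto
    have S: "(\<forall>u\<in>S. ?p + sum x S = of_bool (u \<notin> S) * x u) \<longleftrightarrow> ?p + sum x S = 0"
      using assms(5) by auto
    have outside: "(\<forall>v. v \<notin> R \<union> S \<longrightarrow> x v = 0) \<longleftrightarrow>
        (\<forall>v. v \<notin> R \<union> C \<longrightarrow> x v = 0) \<and> (\<forall>u\<in>C - S. x u = 0)"
      using assms(3,4) by blast
    note iffs = kernel_twin_matrix_iff[OF assms(1-3)] kernel_twin_matrix_iff[OF assms(1) fin disj]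
      C S outside
    show ?thesis
    \<comment> \<open>The sums over \<open>C\<close> and \<open>S\<close> are interchangeable only
      if \<open>x\<close> vanishes on \<open>C - S\<close>; otherwise \<open>x\<close> lies in
      neither kernel.\<close>
    proof (cases "\<forall>u\<in>C - S. x u = 0")
      case True
      show ?thesis unfolding iffs unfolding supp[OF True] by blast
    next
      case False
      then show ?thesis unfolding iffs by blast
    qed
  qed
  then show ?thesis unfolding nullity_def by (metis subsetI subset_antisym)
qed

text \<open>After dropping the untoggled twins, all rows of \<open>S\<close> impose the same
  equation, and \<open>x\<close> enters every equation on \<open>S\<close> only through
  \<open>sum x S\<close>. One toggled vertex \<open>a\<close> can carry that sum; with the sum
  fixed, all coordinates on \<open>S\<close> but one are free, which gives \<open>card S - 1\<close>
  extra dimensions.\<close>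

lemma nullity_twin_matrix_nonempty:
  assumes "finite R" "finite C" "R \<inter> C = {}" "S \<subseteq> C" "S \<noteq> {}" "a \<notin> R"
  shows "nullity (R \<union> C) (twin_matrix R B c S) =
    card S - 1 + nullity (insert a R) (twin_matrix R B c {a})"
proof -
  have fin: "finite S" and disj: "R \<inter> S = {}" using assms finite_subset by auto
  obtain s where s: "s \<in> S" using assms by blast
  let ?K = "kernel (R \<union> S) (twin_matrix R B c S)"
  let ?L = "kernel (insert a R) (twin_matrix R B c {a})"
  \<comment> \<open>\<open>f\<close> stores the sum over \<open>S\<close> at \<open>a\<close> and
    the free coordinates as a subset of \<open>S - {s}\<close>. Its inverse \<open>h\<close>
    recovers the coordinate at \<open>s\<close> by subtracting the free ones from the sum.\<close>
  define f :: "('a \<Rightarrow> bit) \<Rightarrow> ('a \<Rightarrow> bit) \<times> 'a set" where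
    "f x = (\<lambda>v. if v = a then sum x S else if v \<in> R then x v else 0, {v \<in> S - {s}. x v = 1})" for x
  define h :: "('a \<Rightarrow> bit) \<times> 'a set \<Rightarrow> 'a \<Rightarrow> bit" where
    "h p v = (if v \<in> R then fst p v
      else if v = s then fst p a - (\<Sum>u\<in>S - {s}. of_bool (u \<in> snd p))
      else of_bool (v \<in> snd p))" for p v
  have K: "x \<in> ?K \<longleftrightarrow> (\<forall>v. v \<notin> R \<union> S \<longrightarrow> x v = 0) \<and>
      (\<forall>y\<in>R. (\<Sum>z\<in>R. B y z * x z) + c y * sum x S = 0) \<and> (\<Sum>z\<in>R. c z * x z) + sum x S = 0" for x
    unfolding kernel_twin_matrix_iff[OF assms(1) fin disj] using s by auto
  have L: "x \<in> ?L \<longleftrightarrow> (\<forall>v. v \<notin> insert a R \<longrightarrow> x v = 0) \<and>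
      (\<forall>y\<in>R. (\<Sum>z\<in>R. B y z * x z) + c y * x a = 0) \<and> (\<Sum>z\<in>R. c z * x z) + x a = 0" for x
    using kernel_twin_matrix_iff[of R "{a}"] assms(1,6) by auto
  have sum_h: "sum (h p) S = fst p a" if "snd p \<subseteq> S - {s}" for p
  proof -
    have "sum (h p) (S - {s}) = (\<Sum>u\<in>S - {s}. of_bool (u \<in> snd p))"
      using disj by (intro sum.cong) (auto simp: h_def)
    then show ?thesis using s disj by (subst sum.remove[OF fin s]) (auto simp: h_def)
  qed
  have "bij_betw f ?K (?L \<times> Pow (S - {s}))"
  proof (rule bij_betw_byWitness[where f' = h])
    show "\<forall>x\<in>?K. h (f x) = x"
    proof
      fix x assume x: "x \<in> ?K"
      have "(\<Sum>u\<in>S - {s}. of_bool (u \<in> snd (f x))) = sum x (S - {s})"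
        by (intro sum.cong) (auto simp: f_def)
      then have "sum x S - (\<Sum>u\<in>S - {s}. of_bool (u \<in> snd (f x))) = x s"
        by (simp add: sum.remove[OF fin s])
      then show "h (f x) = x"
        using x assms(6) disj s by (auto simp: fun_eq_iff h_def K f_def)
    qed
    show "\<forall>p\<in>?L \<times> Pow (S - {s}). f (h p) = p"
    proof
      fix p assume p: "p \<in> ?L \<times> Pow (S - {s})"
      then have "sum (h p) S = fst p a" by (intro sum_h) auto
      then have "fst (f (h p)) = fst p"
        using p by (auto simp: f_def h_def L fun_eq_iff)
      moreover have "snd (f (h p)) = snd p"
        using p disj by (auto simp: f_def h_def)
      ultimately show "f (h p) = p" by (simp add: prod_eq_iff)
    qed
    show "f ` ?K \<subseteq> ?L \<times> Pow (S - {s})"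
    proof
      fix q assume "q \<in> f ` ?K"
      then obtain x where x: "x \<in> ?K" and q: "q = f x" by blast
      have "(\<Sum>z\<in>R. e z * fst (f x) z) = (\<Sum>z\<in>R. e z * x z)" for e
        using assms(6) by (intro sum.cong) (auto simp: f_def)
      then have "fst (f x) \<in> ?L" using x by (auto simp: K L) (auto simp: f_def)
      moreover have "snd (f x) \<in> Pow (S - {s})" by (auto simp: f_def)
      ultimately show "q \<in> ?L \<times> Pow (S - {s})" by (simp add: q mem_Times_iff)
    qed
    show "h ` (?L \<times> Pow (S - {s})) \<subseteq> ?K"
    proof
      fix x assume "x \<in> h ` (?L \<times> Pow (S - {s}))"
      then obtain p where p: "fst p \<in> ?L" "snd p \<subseteq> S - {s}" and x: "x = h p" by auto
      have "(\<Sum>z\<in>R. e z * h p z) = (\<Sum>z\<in>R. e z * fst p z)" for e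
        by (intro sum.cong) (auto simp: h_def)
      moreover have "\<forall>v. v \<notin> R \<union> S \<longrightarrow> h p v = 0" using p s by (auto simp: h_def)
      ultimately show "x \<in> ?K" unfolding x K sum_h[OF p(2)] using p(1) by (simp add: L)
    qed
  qed
  then have "card ?K = card ?L * card (Pow (S - {s}))"
    by (simp add: bij_betw_same_card card_cartesian_product)
  then have "(2::nat) ^ nullity (R \<union> S) (twin_matrix R B c S) =
      2 ^ (nullity (insert a R) (twin_matrix R B c {a}) + (card S - 1))"
    using assms(1) fin s by (simp add: card_kernel card_Pow power_add)
  then show ?thesis using nullity_twin_matrix_drop[OF assms(1-5)] by simp
qed

section \<open>Nullity when no twin is toggled\<close>

lemma nullity_eq_if_bij_betw:
  assumes "finite I" "finite J" "bij_betw f (kernel I A) (kernel J B)"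
  shows "nullity I A = nullity J B"
  using bij_betw_same_card[OF assms(3)] assms(1,2) by (simp add: card_kernel)

text \<open>Write p for the sum over \<open>R\<close> of \<open>c z * x z\<close>. Each
  \<open>u\<close> in \<open>U\<close> demands p + \<open>sum x U\<close> = \<open>x u\<close>.
  Adding these equations over an odd number of \<open>u\<close> gives p = 0, so \<open>x\<close> is
  constant on \<open>U\<close> with value \<open>sum x U\<close>. This value becomes the coordinate
  of the single vertex \<open>a\<close>.\<close>

lemma nullity_twin_matrix_odd:
  assumes "finite R" "finite U" "R \<inter> U = {}" "odd (card U)" "a \<notin> R"
  shows "nullity (R \<union> U) (twin_matrix R B c {}) = nullity (insert a R) (twin_matrix R B c {})"
proof (rule nullity_eq_if_bij_betw)
  let ?K = "kernel (R \<union> U) (twin_matrix R B c {})"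
  let ?L = "kernel (insert a R) (twin_matrix R B c {})"
  define f :: "('a \<Rightarrow> bit) \<Rightarrow> 'a \<Rightarrow> bit" where
    "f x v = (if v = a then sum x U else if v \<in> R then x v else 0)" for x v
  define h :: "('a \<Rightarrow> bit) \<Rightarrow> 'a \<Rightarrow> bit" where
    "h y v = (if v \<in> R then y v else if v \<in> U then y a else 0)" for y v
  have sum_const: "(\<Sum>u\<in>U. t) = t" for t :: bit
    using assms(4) of_nat_eq_iff by (cases t) (auto elim!: oddE)
  have K: "x \<in> ?K \<longleftrightarrow> (\<forall>v. v \<notin> R \<union> U \<longrightarrow> x v = 0) \<and>
      (\<forall>y\<in>R. (\<Sum>z\<in>R. B y z * x z) + c y * sum x U = 0) \<and>
      (\<Sum>z\<in>R. c z * x z) = 0 \<and> (\<forall>u\<in>U. x u = sum x U)" for x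
  proof -
    have "(\<forall>u\<in>U. p + sum x U = x u) \<longleftrightarrow> p = 0 \<and> (\<forall>u\<in>U. x u = sum x U)" for p
    proof
      assume *: "\<forall>u\<in>U. p + sum x U = x u"
      then have "sum x U = (\<Sum>u\<in>U. p + sum x U)" by simp
      then have "p = 0" unfolding sum_const by simp
      with * show "p = 0 \<and> (\<forall>u\<in>U. x u = sum x U)" by (metis add_0)
    qed (metis add_0)
    then show ?thesis
      unfolding kernel_twin_matrix_iff[OF assms(1-3)] empty_iff not_False_eq_True of_bool_eq mult_1
      by blast
  qed
  have L: "x \<in> ?L \<longleftrightarrow> (\<forall>v. v \<notin> insert a R \<longrightarrow> x v = 0) \<and>
      (\<forall>y\<in>R. (\<Sum>z\<in>R. B y z * x z) + c y * x a = 0) \<and> (\<Sum>z\<in>R. c z * x z) = 0" for x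
    using kernel_twin_matrix_iff[of R "{a}"] assms(1,5) by auto
  have sum_h: "sum (h y) U = y a" for y
  proof -
    have "sum (h y) U = (\<Sum>u\<in>U. y a)"
      using assms(3) by (intro sum.cong) (auto simp: h_def)
    then show ?thesis unfolding sum_const .
  qed
  have sum_R_h: "(\<Sum>z\<in>R. e z * h y z) = (\<Sum>z\<in>R. e z * y z)" for e y
    by (intro sum.cong) (auto simp: h_def)
  have sum_R_f: "(\<Sum>z\<in>R. e z * f x z) = (\<Sum>z\<in>R. e z * x z)" for e x
    using assms(5) by (intro sum.cong) (auto simp: f_def)
  show "bij_betw f ?K ?L"
  proof (rule bij_betw_byWitness[where f' = h])
    show "\<forall>x\<in>?K. h (f x) = x"
    proof (intro ballI ext)
      fix x v assume "x \<in> ?K"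
      then have "v \<in> U \<Longrightarrow> sum x U = x v" "v \<notin> R \<union> U \<Longrightarrow> x v = 0"
        unfolding K by metis+
      then show "h (f x) v = x v" using assms(5) by (auto simp: f_def h_def)
    qed
    show "\<forall>y\<in>?L. f (h y) = y"
      by (auto simp: L f_def sum_h fun_eq_iff) (auto simp: h_def)
    show "f ` ?K \<subseteq> ?L"
    proof (rule image_subsetI)
      fix x assume "x \<in> ?K"
      then have "\<forall>y\<in>R. (\<Sum>z\<in>R. B y z * x z) + c y * sum x U = 0" "(\<Sum>z\<in>R. c z * x z) = 0"
        unfolding K by blast+
      then show "f x \<in> ?L" unfolding L sum_R_f by (simp add: f_def)
    qed
    show "h ` ?L \<subseteq> ?K"
      using assms(3) by (auto simp: K L sum_R_h sum_h) (auto simp: h_def)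
  qed
qed (use assms in auto)

text \<open>The twin equations make \<open>x\<close> constant on \<open>U\<close>, so evenness
  forces \<open>sum x U = 0\<close>. Hence \<open>U\<close> drops out of the equations on
  \<open>R\<close>, and the values on \<open>U\<close> are determined by those on \<open>R\<close>:
  restriction to \<open>R\<close> is a bijection of kernels.\<close>

lemma nullity_twin_matrix_even:
  assumes "finite R" "finite U" "R \<inter> U = {}" "even (card U)"
  shows "nullity (R \<union> U) (twin_matrix R B c {}) = nullity R (twin_matrix R B c {})"
proof (rule nullity_eq_if_bij_betw)
  let ?K = "kernel (R \<union> U) (twin_matrix R B c {})"
  let ?L = "kernel R (twin_matrix R B c {})"
  define f :: "('a \<Rightarrow> bit) \<Rightarrow> 'a \<Rightarrow> bit" where "f x v = (if v \<in> R then x v else 0)" for x v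
  define h :: "('a \<Rightarrow> bit) \<Rightarrow> 'a \<Rightarrow> bit" where
    "h y v = (if v \<in> U then \<Sum>z\<in>R. c z * y z else y v)" for y v
  have sum_const: "(\<Sum>u\<in>U. t) = 0" for t :: bit
    using assms(4) by (cases t) auto
  have K: "x \<in> ?K \<longleftrightarrow> (\<forall>v. v \<notin> R \<union> U \<longrightarrow> x v = 0) \<and>
      (\<forall>y\<in>R. (\<Sum>z\<in>R. B y z * x z) = 0) \<and> (\<forall>u\<in>U. x u = (\<Sum>z\<in>R. c z * x z))" for x
  proof -
    have zero: "sum x U = 0" if "\<forall>u\<in>U. t = x u" for t
    proof -
      have "sum x U = (\<Sum>u\<in>U. t)" using that by (intro sum.cong) auto
      then show ?thesis unfolding sum_const .
    qed
    have "(\<forall>u\<in>U. p + sum x U = x u) \<longleftrightarrow> sum x U = 0 \<and> (\<forall>u\<in>U. x u = p)" for p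
      using zero[of p] zero[of "p + sum x U"] by (metis add.right_neutral)
    then have iff: "x \<in> ?K \<longleftrightarrow> (\<forall>v. v \<notin> R \<union> U \<longrightarrow> x v = 0) \<and>
        (\<forall>y\<in>R. (\<Sum>z\<in>R. B y z * x z) + c y * sum x U = 0) \<and>
        sum x U = 0 \<and> (\<forall>u\<in>U. x u = (\<Sum>z\<in>R. c z * x z))"
      unfolding kernel_twin_matrix_iff[OF assms(1-3)] empty_iff not_False_eq_True of_bool_eq mult_1
      by blast
    \<comment> \<open>If the sum is nonzero, both sides fail: the right-hand side makes
      \<open>x\<close> constant on \<open>U\<close>, which would give sum 0.\<close>
    show ?thesis
    proof (cases "sum x U = 0")
      case True
      then show ?thesis unfolding iff True mult_zero_right add_0_right by blast
    next
      case False
      then show ?thesis using iff zero[of "\<Sum>z\<in>R. c z * x z"] by metis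
    qed
  qed
  have L: "x \<in> ?L \<longleftrightarrow> (\<forall>v. v \<notin> R \<longrightarrow> x v = 0) \<and> (\<forall>y\<in>R. (\<Sum>z\<in>R. B y z * x z) = 0)" for x
    using kernel_twin_matrix_iff[of R "{}"] assms(1) by auto
  have sum_R_h: "(\<Sum>z\<in>R. e z * h y z) = (\<Sum>z\<in>R. e z * y z)" for e y
    using assms(3) by (intro sum.cong) (auto simp: h_def)
  have sum_R_f: "(\<Sum>z\<in>R. e z * f x z) = (\<Sum>z\<in>R. e z * x z)" for e x
    by (intro sum.cong) (auto simp: f_def)
  show "bij_betw f ?K ?L"
  proof (rule bij_betw_byWitness[where f' = h])
    show "\<forall>x\<in>?K. h (f x) = x"
      by (auto simp: K h_def sum_R_f fun_eq_iff) (auto simp: f_def)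
    show "\<forall>y\<in>?L. f (h y) = y"
      using assms(3) by (auto simp: L f_def h_def fun_eq_iff)
    show "f ` ?K \<subseteq> ?L"
      by (auto simp: K L sum_R_f) (auto simp: f_def)
    show "h ` ?L \<subseteq> ?K"
      by (auto simp: K L sum_R_h) (auto simp: h_def)
  qed
qed (use assms in auto)

section \<open>Splitting the bracket sum along the clique\<close>

lemma sum_Pow_Un:
  assumes "finite W" "finite C" "W \<inter> C = {}"
  shows "(\<Sum>T\<in>Pow (W \<union> C). g T) = (\<Sum>T\<in>Pow W. \<Sum>S\<in>Pow C. g (T \<union> S))"
  unfolding sum.cartesian_product
  by (rule sum.reindex_bij_witness[where i = "\<lambda>(T, S). T \<union> S" and j = "\<lambda>T. (T \<inter> W, T \<inter> C)"])
    (use assms(3) in \<open>auto simp flip: Int_Un_distrib simp: Int_absorb2\<close>)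

text \<open>Stated for a set rather than an enumeration. A single unlooped vertex qualifies, so the
  notion also applies to the merged vertex.\<close>

definition clique_twins :: "('v, 'e, 'r) wm_graph \<Rightarrow> 'v set \<Rightarrow> bool" where
  "clique_twins G C \<longleftrightarrow> C \<subseteq> verts G \<and> (\<forall>u\<in>C. \<not> looped G u) \<and>
     (\<forall>u\<in>C. \<forall>w\<in>C. neighbors G u - C = neighbors G w - C) \<and>
     (\<forall>u\<in>C. \<forall>w\<in>C. u \<noteq> w \<longrightarrow> adjacent G u w)"

lemma adjacent_commute: "adjacent G u w \<longleftrightarrow> adjacent G w u"
  by (auto simp: adjacent_def insert_commute)

text \<open>A toggled twin has diagonal entry 1 and is always retained; an untoggled one has 0 and
  is retained only if unmarked. So the retained set is \<open>R\<close> together with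
  \<open>S\<close> and the unmarked twins, where \<open>R\<close> depends on \<open>T\<close> alone,
  and on it the toggled matrix is a twin matrix.\<close>

lemma nullity_retained_twins:
  fixes G :: "('v, 'e, 'r) wm_graph"
  assumes "finite (verts G)" "clique_twins G C" "a \<in> C" "T \<subseteq> verts G - C" "S \<subseteq> C"
  defines "R \<equiv> retained G T - C"
    and "M \<equiv> twin_matrix (retained G T - C) (toggled_matrix G T) (\<lambda>y. of_bool (adjacent G a y))"
  shows "nullity (retained G (T \<union> S)) (toggled_matrix G (T \<union> S)) =
    (if S = {} then if odd (card {u \<in> C. \<not> marked G u}) then nullity (insert a R) (M {})
       else nullity R (M {})
     else card S - 1 + nullity (insert a R) (M {a}))"
proof -
  define U where "U = {u \<in> C. \<not> marked G u}"
  have C: "C \<subseteq> verts G" "\<And>u. u \<in> C \<Longrightarrow> \<not> looped G u"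
      "\<And>u w. u \<in> C \<Longrightarrow> w \<in> C \<Longrightarrow> u \<noteq> w \<Longrightarrow> adjacent G u w"
    using assms(2) by (auto simp: clique_twins_def)
  have nbr: "adjacent G u y \<longleftrightarrow> adjacent G a y" if "u \<in> C" "y \<in> verts G - C" for u y
  proof -
    have "neighbors G u - C = neighbors G a - C"
      using assms(2,3) that(1) unfolding clique_twins_def by blast
    then show ?thesis using that(2) by (auto simp: neighbors_def)
  qed
  have R: "R \<subseteq> verts G - C" by (auto simp: R_def retained_def)
  have fin: "finite R" "finite (S \<union> U)" "finite U"
    using assms(1,5) C(1) R by (auto simp: U_def intro: finite_subset)
  have disj: "R \<inter> (S \<union> U) = {}" "R \<inter> U = {}" "a \<notin> R" using R assms(3,5) by (auto simp: U_def)
  have "retained G (T \<union> S) = R \<union> (S \<union> U)"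
    using C(1,2) assms(4,5)
    by (auto simp: R_def U_def retained_def toggled_matrix_def adj_matrix_def)
  moreover have "nullity (R \<union> (S \<union> U)) (toggled_matrix G (T \<union> S)) = nullity (R \<union> (S \<union> U)) (M S)"
  proof (rule nullity_cong)
    fix u w assume uw: "u \<in> R \<union> (S \<union> U)" "w \<in> R \<union> (S \<union> U)"
    \<comment> \<open>As \<open>T\<close> avoids \<open>C\<close> and \<open>S\<close> lies in it, a
      vertex of \<open>R\<close> is toggled iff it is in \<open>T\<close>, and a twin iff it is in
      \<open>S\<close>.\<close>
    have mem: "x \<in> R \<and> x \<in> verts G - C \<and> x \<notin> S \<or> x \<notin> R \<and> x \<in> C \<and> x \<notin> T"
      if "x \<in> R \<union> (S \<union> U)" for x
      using that R assms(4,5) by (auto simp: U_def)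
    show "toggled_matrix G (T \<union> S) u w = M S u w"
      using mem[OF uw(1)] mem[OF uw(2)] C(2,3) nbr[of u w] nbr[of w u] adjacent_commute[of G u w]
      unfolding M_def R_def[symmetric] twin_matrix_def toggled_matrix_def adj_matrix_def
      by auto
  qed
  ultimately have eq: "nullity (retained G (T \<union> S)) (toggled_matrix G (T \<union> S)) =
      nullity (R \<union> (S \<union> U)) (M S)" by simp
  show ?thesis
  proof (cases "S = {}")
    case False
    \<comment> \<open>Here \<open>S \<union> U\<close>, the retained twins, takes the place of the
      whole clique.\<close>
    then show ?thesis
      unfolding eq M_def R_def[symmetric]
      by (simp add: nullity_twin_matrix_nonempty[OF fin(1,2) disj(1) Un_upper1 False disj(3)])
  next
    case True
    then show ?thesis
      unfolding eq M_def R_def[symmetric] U_def[symmetric]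
      using nullity_twin_matrix_odd[OF fin(1,3) disj(2) _ disj(3)]
        nullity_twin_matrix_even[OF fin(1,3) disj(2)] by simp
  qed
qed

text \<open>The right-hand side is shaped for comparing two graphs: apart from \<open>R\<close> and
  \<open>M\<close>, the clique enters the inner factor only through its product of
  \<open>alpha\<close>, the parity of its unmarked members and one weighted sum over its nonempty
  subsets.\<close>

lemma bracket_clique_twins:
  fixes G :: "('v, 'e, 'r::comm_ring_1) wm_graph"
  assumes "finite (verts G)" "clique_twins G C" "a \<in> C"
  defines "R \<equiv> \<lambda>T. retained G T - C"
    and "M \<equiv> \<lambda>T. twin_matrix (retained G T - C) (toggled_matrix G T) (\<lambda>y. of_bool (adjacent G a y))"
  shows "bracket d G = d ^ free_loops G *
    (\<Sum>T\<in>Pow (verts G - C). (\<Prod>v\<in>verts G - C - T. alpha G v) * (\<Prod>t\<in>T. beta G t) *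
      ((\<Prod>v\<in>C. alpha G v) *
         d ^ (if odd (card {u \<in> C. \<not> marked G u}) then nullity (insert a (R T)) (M T {})
              else nullity (R T) (M T {})) +
       (\<Sum>S\<in>Pow C - {{}}. (\<Prod>v\<in>C - S. alpha G v) * (\<Prod>t\<in>S. beta G t) * d ^ (card S - 1)) *
         d ^ nullity (insert a (R T)) (M T {a})))"
proof -
  define W where "W = verts G - C"
  have C: "C \<subseteq> verts G" using assms(2) by (simp add: clique_twins_def)
  then have fin: "finite W" "finite C" and disj: "W \<inter> C = {}" and V: "verts G = W \<union> C"
    using assms(1) by (auto simp: W_def intro: finite_subset)
  have "(\<Sum>S\<in>Pow C. (\<Prod>v\<in>W \<union> C - (T \<union> S). alpha G v) * (\<Prod>t\<in>T \<union> S. beta G t) *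
        d ^ nullity (retained G (T \<union> S)) (toggled_matrix G (T \<union> S))) =
      (\<Prod>v\<in>W - T. alpha G v) * (\<Prod>t\<in>T. beta G t) *
      ((\<Prod>v\<in>C. alpha G v) *
         d ^ (if odd (card {u \<in> C. \<not> marked G u}) then nullity (insert a (R T)) (M T {})
              else nullity (R T) (M T {})) +
       (\<Sum>S\<in>Pow C - {{}}. (\<Prod>v\<in>C - S. alpha G v) * (\<Prod>t\<in>S. beta G t) * d ^ (card S - 1)) *
         d ^ nullity (insert a (R T)) (M T {a}))" if "T \<in> Pow W" for T
  proof -
    let ?P = "(\<Prod>v\<in>W - T. alpha G v) * (\<Prod>t\<in>T. beta G t)"
    let ?Q = "\<lambda>S. (\<Prod>v\<in>C - S. alpha G v) * (\<Prod>t\<in>S. beta G t)"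
    let ?n = "\<lambda>S. nullity (retained G (T \<union> S)) (toggled_matrix G (T \<union> S))"
    have n: "?n S = (if S = {} then if odd (card {u \<in> C. \<not> marked G u})
          then nullity (insert a (R T)) (M T {}) else nullity (R T) (M T {})
        else card S - 1 + nullity (insert a (R T)) (M T {a}))" if "S \<subseteq> C" for S
      unfolding R_def M_def
      by (rule nullity_retained_twins[OF assms(1-3) _ that]) (use \<open>T \<in> Pow W\<close> in \<open>auto simp: W_def\<close>)
    have "(\<Prod>v\<in>W \<union> C - (T \<union> S). alpha G v) * (\<Prod>t\<in>T \<union> S. beta G t) = ?P * ?Q S"
      if "S \<in> Pow C" for S
    proof -
      have "W \<union> C - (T \<union> S) = (W - T) \<union> (C - S)" using that \<open>T \<in> Pow W\<close> disj by blast
      moreover have "finite S" "finite T" "T \<inter> S = {}" "(W - T) \<inter> (C - S) = {}"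
        using that \<open>T \<in> Pow W\<close> disj fin by (auto intro: finite_subset)
      ultimately show ?thesis using fin by (simp add: prod.union_disjoint mult_ac)
    qed
    then have "(\<Sum>S\<in>Pow C. (\<Prod>v\<in>W \<union> C - (T \<union> S). alpha G v) * (\<Prod>t\<in>T \<union> S. beta G t) * d ^ ?n S) =
        ?P * (\<Sum>S\<in>Pow C. ?Q S * d ^ ?n S)"
      by (simp add: sum_distrib_left mult.assoc)
    also have "(\<Sum>S\<in>Pow C. ?Q S * d ^ ?n S) = ?Q {} * d ^ ?n {} + (\<Sum>S\<in>Pow C - {{}}. ?Q S * d ^ ?n S)"
      using fin(2) by (intro sum.remove) auto
    \<comment> \<open>For nonempty \<open>S\<close> the nullity is \<open>card S - 1\<close> plus a
      number independent of \<open>S\<close>, so a common power of \<open>d\<close> factors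
      out.\<close>
    also have "(\<Sum>S\<in>Pow C - {{}}. ?Q S * d ^ ?n S) =
        (\<Sum>S\<in>Pow C - {{}}. ?Q S * d ^ (card S - 1)) * d ^ nullity (insert a (R T)) (M T {a})"
    proof -
      have "?n S = card S - 1 + nullity (insert a (R T)) (M T {a})" if "S \<in> Pow C - {{}}" for S
        using n[of S] that by simp
      then show ?thesis by (simp add: sum_distrib_right power_add mult.assoc)
    qed
    also have "?n {} = (if odd (card {u \<in> C. \<not> marked G u}) then nullity (insert a (R T)) (M T {})
              else nullity (R T) (M T {}))"
      using n[of "{}"] by simp
    finally show ?thesis by simp
  qed
  then show ?thesis
    unfolding bracket_def W_def[symmetric] unfolding V sum_Pow_Un[OF fin disj] by simp
qed

text \<open>Expand the product of the sums over subsets \<open>S\<close>: the term of the empty set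
  cancels, and every other term contains \<open>d ^ card S\<close>, from which one factor
  \<open>d\<close> is removed.\<close>

lemma sum_Pow_nonempty_quot_by:
  fixes d :: "'r::comm_ring_1"
  assumes "not_zero_divisor d" "finite C"
  shows "quot_by d (- (\<Prod>v\<in>C. a v) + (\<Prod>v\<in>C. a v + d * b v)) =
    (\<Sum>S\<in>Pow C - {{}}. (\<Prod>v\<in>C - S. a v) * (\<Prod>t\<in>S. b t) * d ^ (card S - 1))"
proof (rule quot_by_eqI[OF assms(1)])
  have "(\<Prod>v\<in>C. a v + d * b v) = (\<Sum>S\<in>Pow C. (\<Prod>v\<in>C - S. a v) * (\<Prod>t\<in>S. d * b t))"
    using prod_add[OF assms(2), of "\<lambda>v. d * b v" a] by (simp add: add.commute mult.commute)
  also have "\<dots> = (\<Prod>v\<in>C. a v) + (\<Sum>S\<in>Pow C - {{}}. (\<Prod>v\<in>C - S. a v) * (\<Prod>t\<in>S. d * b t))"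
    using assms(2) by (subst sum.remove[of _ "{}"]) auto
  also have "(\<Sum>S\<in>Pow C - {{}}. (\<Prod>v\<in>C - S. a v) * (\<Prod>t\<in>S. d * b t)) =
      (\<Sum>S\<in>Pow C - {{}}. d * ((\<Prod>v\<in>C - S. a v) * (\<Prod>t\<in>S. b t) * d ^ (card S - 1)))"
  proof (rule sum.cong)
    fix S assume "S \<in> Pow C - {{}}"
    \<comment> \<open>Subtraction on \<open>nat\<close> truncates, so taking one factor
      \<open>d\<close> out of \<open>d ^ card S\<close> requires \<open>S\<close> to be
      nonempty.\<close>
    then have "card S > 0" using assms(2) by (auto simp: card_gt_0_iff intro: finite_subset)
    then have "d ^ card S = d * d ^ (card S - 1)" by (metis Suc_pred' power_Suc)
    then show "(\<Prod>v\<in>C - S. a v) * (\<Prod>t\<in>S. d * b t) =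
        d * ((\<Prod>v\<in>C - S. a v) * (\<Prod>t\<in>S. b t) * d ^ (card S - 1))"
      by (simp add: prod.distrib mult_ac)
  qed simp
  finally show "d * (\<Sum>S\<in>Pow C - {{}}. (\<Prod>v\<in>C - S. a v) * (\<Prod>t\<in>S. b t) * d ^ (card S - 1)) =
      - (\<Prod>v\<in>C. a v) + (\<Prod>v\<in>C. a v + d * b v)"
    by (simp add: sum_distrib_left)
qed

section \<open>Merging the clique into one vertex\<close>

lemma foldl_delete_vertex:
  "foldl delete_vertex G ws =
    G\<lparr>verts := verts G - set ws, edges := {e \<in> edges G. ends G e \<inter> set ws = {}}\<rparr>"
  by (induction ws arbitrary: G) (auto simp: delete_vertex_def simp flip: Diff_insert2)

text \<open>Agreement on \<open>R'\<close> gives equality everywhere, since entries between two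
  indices outside \<open>R'\<close> depend only on \<open>S\<close>.\<close>

lemma twin_matrix_cong:
  assumes "R = R'" "\<And>y z. y \<in> R' \<Longrightarrow> z \<in> R' \<Longrightarrow> B y z = B' y z" "\<And>y. y \<in> R' \<Longrightarrow> c y = c' y"
  shows "twin_matrix R B c S = twin_matrix R' B' c' S"
  using assms by (auto simp: twin_matrix_def fun_eq_iff)

text \<open>In \<open>H\<close> the set \<open>{a}\<close> is itself a clique of twins, so both
  brackets expand in the same form and are compared term by term. The mark of \<open>a\<close>
  matches the parity of the unmarked twins, and its two weights match the terms for empty and
  nonempty \<open>S\<close>.\<close>

lemma bracket_merge_clique_twins:
  fixes G H :: "('v, 'e, 'r::comm_ring_1) wm_graph"
  assumes "not_zero_divisor d" "finite (verts G)" "clique_twins G C" "a \<in> C"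
    and "free_loops H = free_loops G" "verts H = verts G - (C - {a})"
    and looped: "\<And>u. u \<in> verts H \<Longrightarrow> looped H u \<longleftrightarrow> looped G u"
    and adjacent: "\<And>u w. u \<in> verts H \<Longrightarrow> w \<in> verts H \<Longrightarrow> adjacent H u w \<longleftrightarrow> adjacent G u w"
    and "\<And>y. y \<in> verts G - C \<Longrightarrow> marked H y = marked G y \<and> alpha H y = alpha G y \<and> beta H y = beta G y"
    and "marked H a \<longleftrightarrow> even (card {u \<in> C. \<not> marked G u})"
    and "alpha H a = (\<Prod>v\<in>C. alpha G v)"
    and "beta H a = quot_by d (- (\<Prod>v\<in>C. alpha G v) + (\<Prod>v\<in>C. alpha G v + d * beta G v))"
  shows "bracket d G = bracket d H"
proof -
  have C: "C \<subseteq> verts G" "\<not> looped G a" using assms(3,4) by (auto simp: clique_twins_def)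
  have a: "a \<in> verts H" and W: "verts H - {a} = verts G - C" using C assms(4,6) by auto
  have twins: "clique_twins H {a}" using a C(2) by (simp add: clique_twins_def looped)
  have toggled: "toggled_matrix H T y z = toggled_matrix G T y z" if "y \<in> verts H" "z \<in> verts H" for T y z
    using that by (simp add: toggled_matrix_def adj_matrix_def looped adjacent)
  have retained: "retained H T - {a} = retained G T - C" for T
  proof -
    have "retained H T - {a} = {y \<in> verts H - {a}. \<not> (marked H y \<and> toggled_matrix H T y y = 0)}"
      by (auto simp: retained_def)
    also have "\<dots> = {y \<in> verts G - C. \<not> (marked G y \<and> toggled_matrix G T y y = 0)}"
      using W assms(9) toggled by (intro Collect_cong) (metis DiffD1)
    also have "\<dots> = retained G T - C" by (auto simp: retained_def)
    finally show ?thesis .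
  qed
  have matrix: "twin_matrix (retained H T - {a}) (toggled_matrix H T) (\<lambda>y. of_bool (adjacent H a y)) S =
      twin_matrix (retained G T - C) (toggled_matrix G T) (\<lambda>y. of_bool (adjacent G a y)) S" for T S
    unfolding retained
  proof (rule twin_matrix_cong)
    have "y \<in> verts H" if "y \<in> retained G T - C" for y
      using that W by (auto simp: retained_def)
    then show "\<And>y z. y \<in> retained G T - C \<Longrightarrow> z \<in> retained G T - C \<Longrightarrow>
        toggled_matrix H T y z = toggled_matrix G T y z"
      and "\<And>y. y \<in> retained G T - C \<Longrightarrow> of_bool (adjacent H a y) = of_bool (adjacent G a y)"
      using a by (simp_all add: toggled adjacent)
  qed simp
  have odd: "odd (card {u \<in> {a}. \<not> marked H u}) \<longleftrightarrow> odd (card {u \<in> C. \<not> marked G u})"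
  proof -
    have "{u \<in> {a}. \<not> marked H u} = (if marked H a then {} else {a})" by auto
    then show ?thesis using assms(10) by simp
  qed
  \<comment> \<open>For the clique \<open>{a}\<close> the sum over nonempty subsets is the single
    term \<open>beta H a\<close>, with \<open>d\<close> to the power 0.\<close>
  have "Pow {a} - {{}} = {{a}}" by auto
  then have beta: "(\<Sum>S\<in>Pow {a} - {{}}. (\<Prod>v\<in>{a} - S. alpha H v) * (\<Prod>t\<in>S. beta H t) * d ^ (card S - 1)) =
      (\<Sum>S\<in>Pow C - {{}}. (\<Prod>v\<in>C - S. alpha G v) * (\<Prod>t\<in>S. beta G t) * d ^ (card S - 1))"
    using sum_Pow_nonempty_quot_by[OF assms(1) finite_subset[OF C(1) assms(2)],
        of "alpha G" "beta G"] assms(12) by simp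
  have prods: "(\<Prod>v\<in>verts G - C - T. alpha H v) = (\<Prod>v\<in>verts G - C - T. alpha G v)"
      "(\<Prod>t\<in>T. beta H t) = (\<Prod>t\<in>T. beta G t)" if "T \<in> Pow (verts G - C)" for T
    using that assms(9) by (auto intro!: prod.cong)
  have fin: "finite (verts H)" using assms(2,6) by simp
  show ?thesis
    unfolding bracket_clique_twins[OF assms(2-4)] bracket_clique_twins[OF fin twins insertI1] matrix
    unfolding retained W odd beta assms(5)
    by (intro arg_cong[where f = "\<lambda>x. d ^ free_loops G * x"] sum.cong refl) (simp add: prods assms(11))
qed

theorem theorem3:
  fixes G :: "('v, 'e, 'r::comm_ring_1) wm_graph"
    and d :: 'r
    and v :: "nat \<Rightarrow> 'v"
    and k :: nat
  defines "\<rho> \<equiv> card {i \<in> {1..k}. \<not> marked G (v i)}"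
    and "\<alpha>' \<equiv> (\<Prod>i=1..k. alpha G (v i))"
    and "\<beta>' \<equiv> quot_by d (- (\<Prod>i=1..k. alpha G (v i)) +
                           (\<Prod>i=1..k. alpha G (v i) + d * beta G (v i)))"
    and "H \<equiv> foldl delete_vertex G (map v [2..<Suc k])"
  assumes "not_zero_divisor d"
    and "wf_graph G"
    and "k \<ge> 1"
    and "inj_on v {1..k}"
    and "v ` {1..k} \<subseteq> verts G"
    and "\<forall>i\<in>{1..k}. \<not> looped G (v i)"
    and "\<forall>i\<in>{1..k}. \<forall>j\<in>{1..k}. neighbors G (v i) - v ` {1..k} = neighbors G (v j) - v ` {1..k}"
    and "\<forall>i\<in>{1..k}. \<forall>j\<in>{1..k}. i \<noteq> j \<longrightarrow> adjacent G (v i) (v j)"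
  shows "bracket d G = bracket d (H\<lparr>marked := (marked H)(v 1 := even \<rho>),
                                    alpha := (alpha H)(v 1 := \<alpha>'),
                                    beta := (beta H)(v 1 := \<beta>')\<rparr>)"
proof (rule bracket_merge_clique_twins[where C = "v ` {1..k}" and a = "v 1"])
  let ?C = "v ` {1..k}"
  have one: "v 1 \<in> ?C" using assms(7) by simp
  have "{1..k} = insert 1 {2..k}" using assms(7) by auto
  \<comment> \<open>Injectivity ensures that \<open>v 1\<close> is not among the deleted
    vertices.\<close>
  then have "?C - {v 1} = v ` {2..k}"
    using assms(8) by (auto simp: inj_on_def)
  moreover have "set [2..<Suc k] = {2..k}" by auto
  ultimately have D: "set (map v [2..<Suc k]) = ?C - {v 1}" by (simp only: set_map)
  note H = H_def[unfolded foldl_delete_vertex D]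
  \<comment> \<open>\<open>\<rho>\<close> counts indices while the merging lemma counts vertices;
    injectivity reconciles the two.\<close>
  have card_eq: "card {u \<in> ?C. \<not> marked G u} = \<rho>"
  proof -
    have "{u \<in> ?C. \<not> marked G u} = v ` {i \<in> {1..k}. \<not> marked G (v i)}" by blast
    moreover have "inj_on v {i \<in> {1..k}. \<not> marked G (v i)}"
      using assms(8) by (rule inj_on_subset) blast
    ultimately show ?thesis unfolding \<rho>_def by (simp only: card_image)
  qed
  let ?H = "H\<lparr>marked := (marked H)(v 1 := even \<rho>), alpha := (alpha H)(v 1 := \<alpha>'),
    beta := (beta H)(v 1 := \<beta>')\<rparr>"
  show "not_zero_divisor d" by fact
  show "finite (verts G)" using assms(6) by (simp add: wf_graph_def)
  show "clique_twins G ?C"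
    unfolding clique_twins_def ball_simps(9)
  proof (intro conjI ballI impI)
    fix i j assume "i \<in> {1..k}" "j \<in> {1..k}" "v i \<noteq> v j"
    then show "adjacent G (v i) (v j)" using assms(12) by metis
  qed (use assms(9,10) in blast, use assms(10) in blast, use assms(11) in metis)
  show "v 1 \<in> ?C" by (fact one)
  show "free_loops ?H = free_loops G" and verts: "verts ?H = verts G - (?C - {v 1})"
    by (simp_all add: H)
  show "looped ?H u \<longleftrightarrow> looped G u" if "u \<in> verts ?H" for u
  proof -
    \<comment> \<open>An edge whose end-points all survive is not deleted, so loops at remaining
      vertices persist.\<close>
    have "ends G e \<inter> (?C - {v 1}) = {} \<and> ends G e = {u} \<longleftrightarrow> ends G e = {u}" for e
      using that unfolding verts by auto
    then show ?thesis by (simp add: looped_def H conj_assoc Bex_def)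
  qed
  show "adjacent ?H u w \<longleftrightarrow> adjacent G u w" if "u \<in> verts ?H" "w \<in> verts ?H" for u w
  proof -
    have "ends G e \<inter> (?C - {v 1}) = {} \<and> ends G e = {u, w} \<longleftrightarrow> ends G e = {u, w}" for e
      using that unfolding verts by auto
    then show ?thesis by (simp add: adjacent_def H conj_assoc Bex_def)
  qed
  show "marked ?H y = marked G y \<and> alpha ?H y = alpha G y \<and> beta ?H y = beta G y"
    if "y \<in> verts G - ?C" for y
    using that one by (auto simp: H)
  show "marked ?H (v 1) \<longleftrightarrow> even (card {u \<in> ?C. \<not> marked G u})" unfolding card_eq by simp
  show "alpha ?H (v 1) = (\<Prod>u\<in>?C. alpha G u)"
    using assms(8) by (simp add: \<alpha>'_def prod.reindex)
  show "beta ?H (v 1) = quot_by d (- (\<Prod>u\<in>?C. alpha G u) + (\<Prod>u\<in>?C. alpha G u + d * beta G u))"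
    using assms(8) by (simp add: \<beta>'_def prod.reindex)
qed

end
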